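(* For all integers $j\geq 0$, $n\geq 0$ and $k\geq 1$, we have $O_{j,k}(n)=D_{j,k}(n)$, where $O_{j,k}(n)$ denotes the number of partitions of $n$ having exactly $j$ different part sizes that are divisible by $k$ (each such part size possibly repeated), and $D_{j,k}(n)$ denotes the number of partitions of $n$ having exactly $j$ different part sizes that each occur at least $k$ times.
   Context: A partition of a nonnegative integer $n$ is a finite weakly decreasing sequence of positive integers (its parts) summing to $n$; the empty partition is the unique partition of $0$. "Different part sizes" means distinct values among the parts. For $O_{j,k}(n)$ one counts the number of distinct values $v$ with $v\equiv 0\pmod{k}$ that occur as parts; for $D_{j,k}(n)$ one counts the number of distinct values $v$ that occur as a part with multiplicity at least $k$. *)

theory Defs
  imports Main
begin

definition is_partition :: "nat \<Rightarrow> nat list \<Rightarrow> bool" where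
  "is_partition n xs \<longleftrightarrow> sorted_wrt (\<ge>) xs \<and> (\<forall>x\<in>set xs. 0 < x) \<and> sum_list xs = n"

definition partitions :: "nat \<Rightarrow> nat list set" where
  "partitions n = {xs. is_partition n xs}"

text \<open>Since \<^const>\<open>card\<close> is 0 on infinite sets, the counts below are meaningful only because
  a number has finitely many partitions.\<close>

lemma finite_partitions: "finite (partitions n)"
proof (rule finite_subset)
  have len: "length xs \<le> sum_list xs" if "\<forall>x\<in>set xs. 0 < x" for xs :: "nat list"
    using that by (induction xs) (auto simp: Suc_le_eq)
  show "partitions n \<subseteq> {xs. set xs \<subseteq> {..n} \<and> length xs \<le> n}"
    using len by (auto simp: partitions_def is_partition_def intro: member_le_sum_list)
  show "finite {xs. set xs \<subseteq> {..n} \<and> length xs \<le> n}"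
    by (rule finite_lists_length_le) simp
qed

definition O_count :: "nat \<Rightarrow> nat \<Rightarrow> nat \<Rightarrow> nat" where
  "O_count j k n = card {xs \<in> partitions n. card {v \<in> set xs. k dvd v} = j}"

definition D_count :: "nat \<Rightarrow> nat \<Rightarrow> nat \<Rightarrow> nat" where
  "D_count j k n = card {xs \<in> partitions n. card {v \<in> set xs. k \<le> count_list xs v} = j}"

end

theory Submission
  imports Defs "HOL-Library.Multiset"
begin

text \<open>
  A finer statement holds: for every set \<open>T\<close>, as many partitions of \<open>n\<close> have \<open>{k * v |v. v \<in> T}\<close> as
  their set of part sizes divisible by \<open>k\<close> as have \<open>T\<close> as their set of part sizes of multiplicity
  at least \<open>k\<close>. By inclusion-exclusion it is enough to compare the numbers of partitions for which
  these sets contain \<open>T\<close>. There, replacing one copy of \<open>k * v\<close> by \<open>k\<close> copies of \<open>v\<close> for each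
  \<open>v \<in> T\<close> is a bijection.
\<close>

lemma card_eq_sum_card_fibres:
  assumes "finite C" "finite \<S>"
  shows "card {c \<in> C. f c \<in> \<S>} = (\<Sum>S\<in>\<S>. card {c \<in> C. f c = S})"
proof -
  have "{c \<in> C. f c \<in> \<S>} = (\<Union>S\<in>\<S>. {c \<in> C. f c = S})"
    by auto
  also have "card \<dots> = (\<Sum>S\<in>\<S>. card {c \<in> C. f c = S})"
    using assms by (intro card_UN_disjoint) auto
  finally show ?thesis .
qed

text \<open>Inclusion-exclusion, phrased as an induction from large \<open>T\<close> down to small.
  The number of \<open>a\<close> with \<open>T \<subseteq> g a\<close> is the sum of the fibre sizes
  over all \<open>S\<close> between \<open>T\<close> and \<open>U\<close>. The fibres over strictly
  larger \<open>S\<close> agree by induction, so cancelling them leaves the fibre over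
  \<open>T\<close>.\<close>

lemma card_fibres_eq_if_card_supersets_eq:
  assumes fin: "finite A" "finite B" "finite U"
    and sub: "\<And>a. a \<in> A \<Longrightarrow> g a \<subseteq> U" "\<And>b. b \<in> B \<Longrightarrow> h b \<subseteq> U"
    and eq: "\<And>T. T \<subseteq> U \<Longrightarrow> card {a \<in> A. T \<subseteq> g a} = card {b \<in> B. T \<subseteq> h b}"
    and T: "T \<subseteq> U"
  shows "card {a \<in> A. g a = T} = card {b \<in> B. h b = T}"
  using T
proof (induction "card (U - T)" arbitrary: T rule: less_induct)
  case less
  define \<S> where "\<S> = {S. T \<subset> S \<and> S \<subseteq> U}"
  have finS: "finite (insert T \<S>)" and notin: "T \<notin> \<S>"
    using fin(3) by (simp_all add: \<S>_def)
  have "{a \<in> A. T \<subseteq> g a} = {a \<in> A. g a \<in> insert T \<S>}"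
    "{b \<in> B. T \<subseteq> h b} = {b \<in> B. h b \<in> insert T \<S>}"
    using sub by (auto simp: \<S>_def)
  then have "(\<Sum>S\<in>insert T \<S>. card {a \<in> A. g a = S}) = (\<Sum>S\<in>insert T \<S>. card {b \<in> B. h b = S})"
    using eq[OF less.prems] fin(1,2) finS by (simp only: card_eq_sum_card_fibres)
  moreover have "card {a \<in> A. g a = S} = card {b \<in> B. h b = S}" if "S \<in> \<S>" for S
  proof (rule less.hyps)
    show "card (U - S) < card (U - T)"
      using that fin(3) by (intro psubset_card_mono) (auto simp: \<S>_def)
    show "S \<subseteq> U"
      using that by (simp add: \<S>_def)
  qed
  then have "(\<Sum>S\<in>\<S>. card {a \<in> A. g a = S}) = (\<Sum>S\<in>\<S>. card {b \<in> B. h b = S})"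
    by (rule sum.cong[OF refl])
  ultimately show ?case
    using finS notin by simp
qed

text \<open>Summing the equality of fibres over all \<open>j\<close>-element subsets of
  \<open>U\<close> reduces the comparison of set sizes to containment counts.\<close>

lemma card_statistic_eq_if_card_supersets_eq:
  assumes fin: "finite A" "finite B" "finite U"
    and sub: "\<And>a. a \<in> A \<Longrightarrow> g a \<subseteq> U" "\<And>b. b \<in> B \<Longrightarrow> h b \<subseteq> U"
    and eq: "\<And>T. T \<subseteq> U \<Longrightarrow> card {a \<in> A. T \<subseteq> g a} = card {b \<in> B. T \<subseteq> h b}"
  shows "card {a \<in> A. card (g a) = j} = card {b \<in> B. card (h b) = j}"
proof -
  define \<S> where "\<S> = {S. S \<subseteq> U \<and> card S = j}"
  have finS: "finite \<S>"
    using fin(3) by (simp add: \<S>_def)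
  have "card {a \<in> A. g a = S} = card {b \<in> B. h b = S}" if "S \<in> \<S>" for S
    using that by (intro card_fibres_eq_if_card_supersets_eq[OF assms]) (auto simp: \<S>_def)
  then have "card {a \<in> A. g a \<in> \<S>} = card {b \<in> B. h b \<in> \<S>}"
    using fin(1,2) finS by (simp add: card_eq_sum_card_fibres)
  moreover have "{a \<in> A. card (g a) = j} = {a \<in> A. g a \<in> \<S>}"
    "{b \<in> B. card (h b) = j} = {b \<in> B. h b \<in> \<S>}"
    using sub by (auto simp: \<S>_def)
  ultimately show ?thesis
    by simp
qed

text \<open>Without an order on the parts, exchanging some of them is plain multiset subtraction and
  addition, with no sorting afterwards.\<close>

definition mset_partitions :: "nat \<Rightarrow> nat multiset set" where
  "mset_partitions n = {M. 0 \<notin># M \<and> sum_mset M = n}"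

lemma bij_betw_mset_partitions: "bij_betw mset (partitions n) (mset_partitions n)"
proof (rule bij_betwI')
  fix xs ys assume "xs \<in> partitions n" "ys \<in> partitions n"
  \<comment> \<open>Reversal turns weakly decreasing lists into ascending ones, which are determined
    by their multisets.\<close>
  then have "sorted (rev xs)" "sorted (rev ys)"
    by (auto simp: partitions_def is_partition_def sorted_wrt_rev)
  then show "mset xs = mset ys \<longleftrightarrow> xs = ys"
    by (metis mset_rev properties_for_sort rev_rev_ident)
next
  fix xs assume "xs \<in> partitions n"
  then show "mset xs \<in> mset_partitions n"
    by (auto simp: partitions_def is_partition_def mset_partitions_def sum_mset_sum_list)
next
  fix M assume M: "M \<in> mset_partitions n"
  let ?xs = "rev (sorted_list_of_multiset M)"
  have mset: "mset ?xs = M"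
    by simp
  have "sum_list ?xs = n"
    using M mset by (metis (mono_tags, lifting) mem_Collect_eq mset_partitions_def sum_mset_sum_list)
  moreover have "sorted_wrt (\<ge>) ?xs"
    by (simp add: sorted_wrt_rev sorted_sorted_list_of_multiset)
  moreover have "\<forall>x\<in>set ?xs. 0 < x"
    using M by (auto simp: mset_partitions_def intro: Suc_leI) (metis gr0I)
  ultimately have "?xs \<in> partitions n"
    by (simp add: partitions_def is_partition_def)
  then show "\<exists>xs\<in>partitions n. M = mset xs"
    using mset by metis
qed

lemma finite_mset_partitions: "finite (mset_partitions n)"
  using bij_betw_finite[OF bij_betw_mset_partitions] finite_partitions by blast

lemma card_partitions_mset:
  "card {xs \<in> partitions n. P (mset xs)} = card {M \<in> mset_partitions n. P M}"
proof (rule bij_betw_same_card)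
  show "bij_betw mset {xs \<in> partitions n. P (mset xs)} {M \<in> mset_partitions n. P M}"
    using bij_betw_mset_partitions[of n] by (auto simp: bij_betw_def inj_on_def)
qed

text \<open>Exchanging the submultiset \<open>R\<close> for \<open>R'\<close> preserves the total,
  and exchanging back is the inverse.\<close>

lemma card_mset_partitions_containing:
  assumes "0 \<notin># R" "0 \<notin># R'" "sum_mset R = sum_mset R'"
  shows "card {M \<in> mset_partitions n. R \<subseteq># M} = card {M \<in> mset_partitions n. R' \<subseteq># M}"
proof (rule bij_betw_same_card)
  have swap: "M - Q + Q' \<in> {M \<in> mset_partitions n. Q' \<subseteq># M}"
    if "M \<in> {M \<in> mset_partitions n. Q \<subseteq># M}" "0 \<notin># Q'" "sum_mset Q = sum_mset Q'" for M Q Q'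
  proof -
    \<comment> \<open>Since \<open>Q\<close> is contained in \<open>M\<close>, the truncating
      multiset difference removes exactly \<open>Q\<close>, and the result is
      \<open>N + Q'\<close>.\<close>
    from that(1) obtain N where "M = Q + N"
      by (auto simp: mset_subset_eq_exists_conv)
    then show ?thesis
      using that by (auto simp: mset_partitions_def)
  qed
  show "bij_betw (\<lambda>M. M - R + R') {M \<in> mset_partitions n. R \<subseteq># M} {M \<in> mset_partitions n. R' \<subseteq># M}"
  proof (rule bij_betw_byWitness[where f' = "\<lambda>M. M - R' + R"])
    show "(\<lambda>M. M - R + R') ` {M \<in> mset_partitions n. R \<subseteq># M} \<subseteq> {M \<in> mset_partitions n. R' \<subseteq># M}"
      using swap assms(2,3) by blast
    show "(\<lambda>M. M - R' + R) ` {M \<in> mset_partitions n. R' \<subseteq># M} \<subseteq> {M \<in> mset_partitions n. R \<subseteq># M}"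
      using swap assms(1) assms(3)[symmetric] by blast
  qed auto
qed

lemma le_sum_mset_if_mem:
  fixes x :: nat
  assumes "x \<in># M"
  shows "x \<le> sum_mset M"
  using assms by (auto dest: multi_member_split)

lemma mset_set_subseteq_iff:
  assumes "finite S"
  shows "mset_set S \<subseteq># M \<longleftrightarrow> S \<subseteq> set_mset M"
  using assms by (auto simp: subseteq_mset_def count_mset_set' Suc_le_eq)

lemma repeat_mset_set_subseteq_iff:
  assumes "finite S"
  shows "repeat_mset k (mset_set S) \<subseteq># M \<longleftrightarrow> S \<subseteq> {v. k \<le> count M v}"
  using assms by (auto simp: subseteq_mset_def count_mset_set')

text \<open>Both conditions on \<open>M\<close> say that it contains a fixed multiset: one copy of
  each \<open>k * v\<close>, respectively \<open>k\<close> copies of each \<open>v\<close>, for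
  \<open>v\<close> in \<open>T\<close>. Both multisets have sum \<open>k * \<Sum>T\<close>, so they
  can be exchanged.\<close>

lemma card_mset_partitions_supersets:
  assumes k: "k \<ge> 1" and T: "T \<subseteq> {0<..n}"
  shows "card {M \<in> mset_partitions n. T \<subseteq> {v. k * v \<in># M}} =
    card {M \<in> mset_partitions n. T \<subseteq> {v. k \<le> count M v}}"
proof -
  have finT: "finite T"
    using T finite_subset by blast
  have inj: "inj_on ((*) k) T"
    using k by (simp add: inj_on_def)
  have "T \<subseteq> {v. k * v \<in># M} \<longleftrightarrow> mset_set ((*) k ` T) \<subseteq># M" for M
    using finT by (auto simp: mset_set_subseteq_iff)
  moreover have "sum_mset (mset_set ((*) k ` T)) = sum_mset (repeat_mset k (mset_set T))"
  proof -
    have "sum_mset (mset_set ((*) k ` T)) = (\<Sum>v\<in>T. k * v)"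
      using inj by (simp add: sum_unfold_sum_mset flip: image_mset_mset_set)
    also have "\<dots> = k * \<Sum>T"
      by (simp add: sum_distrib_left)
    also have "\<dots> = sum_mset (repeat_mset k (mset_set T))"
      by (induction k) (simp_all add: sum_unfold_sum_mset)
    finally show ?thesis .
  qed
  then have "card {M \<in> mset_partitions n. mset_set ((*) k ` T) \<subseteq># M} =
      card {M \<in> mset_partitions n. repeat_mset k (mset_set T) \<subseteq># M}"
    using k T finT by (intro card_mset_partitions_containing) (auto simp: not_in_iff count_mset_set')
  ultimately show ?thesis
    using finT by (simp add: repeat_mset_set_subseteq_iff)
qed

theorem theorem1p4:
  fixes j n k :: nat
  assumes "k \<ge> 1"
  shows "O_count j k n = D_count j k n"
proof -
  \<comment> \<open>Multiples of \<open>k\<close> are replaced by their quotients, so that both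
    statistics become subsets of one set and can be compared with the same \<open>T\<close>.\<close>
  have "{v \<in> set xs. k dvd v} = (*) k ` {v. k * v \<in># mset xs}" for xs
    by auto
  then have "card {v \<in> set xs. k dvd v} = card {v. k * v \<in># mset xs}" for xs
    using assms by (simp add: card_image inj_on_def)
  then have "O_count j k n = card {M \<in> mset_partitions n. card {v. k * v \<in># M} = j}"
    unfolding O_count_def by (simp only: card_partitions_mset[where P = "\<lambda>M. card {v. k * v \<in># M} = j"])
  also have "\<dots> = card {M \<in> mset_partitions n. card {v. k \<le> count M v} = j}"
  \<comment> \<open>Parts of a partition of \<open>n\<close> lie in \<open>{0<..n}\<close>, and so
    do the quotients of those divisible by \<open>k\<close>.\<close>
  proof (rule card_statistic_eq_if_card_supersets_eq[where U = "{0<..n}"])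
    fix M assume M: "M \<in> mset_partitions n"
    have "v \<in> {0<..n}" if "k * v \<in># M" for v
    proof -
      have "0 < k * v" "k * v \<le> n"
        using M that le_sum_mset_if_mem[OF that] by (auto simp: mset_partitions_def intro!: Nat.gr0I)
      moreover from assms have "1 * v \<le> k * v"
        by (rule mult_le_mono1)
      ultimately have "0 < v" "v \<le> n"
        by (simp, linarith)
      then show ?thesis
        by simp
    qed
    then show "{v. k * v \<in># M} \<subseteq> {0<..n}"
      by blast
    have "v \<in> {0<..n}" if "k \<le> count M v" for v
    proof -
      \<comment> \<open>As \<open>k\<close> is positive, multiplicity at least \<open>k\<close>
        forces \<open>v\<close> to occur.\<close>
      have "v \<in># M"
        using that assms by (simp flip: count_greater_zero_iff)
      then show ?thesis
        using M le_sum_mset_if_mem by (auto simp: mset_partitions_def intro!: Nat.gr0I)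
    qed
    then show "{v. k \<le> count M v} \<subseteq> {0<..n}"
      by blast
  qed (use assms finite_mset_partitions card_mset_partitions_supersets in auto)
  also have "\<dots> = D_count j k n"
  proof -
    \<comment> \<open>Positivity of \<open>k\<close> again makes membership in \<open>set xs\<close>
      automatic.\<close>
    have "{v \<in> set xs. k \<le> count_list xs v} = {v. k \<le> count (mset xs) v}" for xs :: "nat list"
      using assms by (auto simp: count_mset intro: ccontr)
    then show ?thesis
      unfolding D_count_def by (simp only: card_partitions_mset[where P = "\<lambda>M. card {v. k \<le> count M v} = j"])
  qed
  finally show ?thesis .
qed

end
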